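(* Let $k\ge2$, let $\Omega\subset\{1,\dots,k\}^{\mathbb{Z}}$ be a subshift and let $\mu$ be an ergodic shift-invariant probability measure on $\Omega$. Suppose there exists $i\in\{1,\dots,k\}$ such that for any integer $N>0$, $\mu(\{\omega:\ \omega_0=\omega_1=\cdots=\omega_{N-1}=i\})>0$. Then for any function $v:\{1,\dots,k\}\to\mathbb{R}$ we have $[-2+v(i),\,2+v(i)]\subset\Sigma_v$.
   Context: A subshift $\Omega\subset\{1,\dots,k\}^{\mathbb{Z}}$ is a nonempty compact (product topology of discrete spaces) set invariant under the shift $T$, $(T\omega)_n=\omega_{n+1}$. For $v:\{1,\dots,k\}\to\mathbb{R}$ and $\omega\in\Omega$, let $H_\omega$ be the operator on $\ell^2(\mathbb{Z})$ given by $(H_\omega u)_n=u_{n+1}+u_{n-1}+v(\omega_n)u_n$. By ergodicity, the spectrum of $H_\omega$ is the same set for $\mu$-almost every $\omega$; this almost sure spectrum is denoted $\Sigma_v$. *)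

theory Defs
  imports "HOL-Probability.Probability"
begin

subsection \<open>Subshifts and ergodic measures\<close>

definition shift :: "(int \<Rightarrow> 'a) \<Rightarrow> int \<Rightarrow> 'a" where
  "shift \<omega> = (\<lambda>n. \<omega> (n + 1))"

text \<open>Compactness refers to the type-class topology on \<^typ>\<open>int \<Rightarrow> nat\<close>, which is the product of
  the discrete topologies.\<close>

definition subshift :: "nat \<Rightarrow> (int \<Rightarrow> nat) set \<Rightarrow> bool" where
  "subshift k \<Omega> \<longleftrightarrow>
     \<Omega> \<noteq> {} \<and> \<Omega> \<subseteq> UNIV \<rightarrow> {1..k} \<and> compact \<Omega> \<and> shift ` \<Omega> = \<Omega>"

definition shift_invariant_prob :: "(int \<Rightarrow> nat) set \<Rightarrow> (int \<Rightarrow> nat) measure \<Rightarrow> bool" where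
  "shift_invariant_prob \<Omega> \<mu> \<longleftrightarrow>
     prob_space \<mu> \<and> sets \<mu> = sets (restrict_space borel \<Omega>) \<and>
     (\<forall>A\<in>sets \<mu>. emeasure \<mu> (shift -` A \<inter> space \<mu>) = emeasure \<mu> A)"

definition ergodic_prob :: "(int \<Rightarrow> nat) set \<Rightarrow> (int \<Rightarrow> nat) measure \<Rightarrow> bool" where
  "ergodic_prob \<Omega> \<mu> \<longleftrightarrow>
     shift_invariant_prob \<Omega> \<mu> \<and>
     (\<forall>A\<in>sets \<mu>. shift -` A \<inter> space \<mu> = A \<longrightarrow> emeasure \<mu> A = 0 \<or> emeasure \<mu> A = 1)"


subsection \<open>Bounded operators and spectra on \<open>\<ell>\<^sup>2(\<int>)\<close>\<close>

definition ell2 :: "(int \<Rightarrow> complex) set" where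
  "ell2 = {u. (\<lambda>n. (cmod (u n))\<^sup>2) summable_on UNIV}"

definition ell2_norm :: "(int \<Rightarrow> complex) \<Rightarrow> real" where
  "ell2_norm u = sqrt (\<Sum>\<^sub>\<infinity>n. (cmod (u n))\<^sup>2)"

text \<open>Operators on \<^const>\<open>ell2\<close> are total functions on sequences; only their values on
  \<^const>\<open>ell2\<close> are relevant.\<close>

definition bounded_op :: "((int \<Rightarrow> complex) \<Rightarrow> (int \<Rightarrow> complex)) \<Rightarrow> bool" where
  "bounded_op A \<longleftrightarrow>
     A \<in> ell2 \<rightarrow> ell2 \<and>
     (\<forall>u\<in>ell2. \<forall>w\<in>ell2. A (\<lambda>n. u n + w n) = (\<lambda>n. A u n + A w n)) \<and>
     (\<forall>c. \<forall>u\<in>ell2. A (\<lambda>n. c * u n) = (\<lambda>n. c * A u n)) \<and>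
     (\<exists>C. \<forall>u\<in>ell2. ell2_norm (A u) \<le> C * ell2_norm u)"

definition resolvent_set :: "((int \<Rightarrow> complex) \<Rightarrow> (int \<Rightarrow> complex)) \<Rightarrow> complex set" where
  "resolvent_set A =
     {z. \<exists>R. bounded_op R \<and>
        (\<forall>u\<in>ell2. R (\<lambda>n. A u n - z * u n) = u) \<and>
        (\<forall>u\<in>ell2. (\<lambda>n. A (R u) n - z * R u n) = u)}"

definition spectrum :: "((int \<Rightarrow> complex) \<Rightarrow> (int \<Rightarrow> complex)) \<Rightarrow> complex set" where
  "spectrum A = - resolvent_set A"


subsection \<open>Schroedinger operators and the almost sure spectrum\<close>

definition schroedinger ::
  "(nat \<Rightarrow> real) \<Rightarrow> (int \<Rightarrow> nat) \<Rightarrow> (int \<Rightarrow> complex) \<Rightarrow> (int \<Rightarrow> complex)" where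
  "schroedinger v \<omega> u = (\<lambda>n. u (n + 1) + u (n - 1) + complex_of_real (v (\<omega> n)) * u n)"

text \<open>The description is well defined when \<open>\<mu>\<close> is ergodic: ergodicity gives existence, and a
  probability measure admits at most one such set.\<close>

definition almost_sure_spectrum :: "(int \<Rightarrow> nat) measure \<Rightarrow> (nat \<Rightarrow> real) \<Rightarrow> complex set" where
  "almost_sure_spectrum \<mu> v = (THE S. AE \<omega> in \<mu>. spectrum (schroedinger v \<omega>) = S)"

end

theory Submission
  imports Defs
begin

text \<open>
  A block of \<open>N\<close> consecutive sites with the symbol \<open>i\<close> looks to the operator like \<open>N\<close> sites of the free
  operator with constant potential \<open>v i\<close>. If \<open>E = v i + 2 cos \<theta>\<close>, the plane wave \<open>exp (\<i> \<theta> n)\<close> cut off to the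
  block has norm \<open>sqrt N\<close>, while \<open>(H - E) u\<close> lives on four sites at the ends of the block and has norm at
  most 2. A sequence \<open>\<omega>\<close> with arbitrarily long \<open>i\<close>-blocks therefore admits no bound
  \<open>\<parallel>u\<parallel> \<le> C \<parallel>(H - E) u\<parallel>\<close>, so \<open>E\<close> is in the spectrum (\<open>constant_blocks_spectrum\<close>).

  Since the almost sure spectrum is given by a definite description, it also has to be shown that the
  spectrum is almost surely constant. The route taken is that the spectrum of \<open>H\<^sub>\<omega>\<close> depends only on the set
  of finite words occurring in \<open>\<omega>\<close> (\<open>spectrum_eq_if_same_words\<close>). The set of \<open>\<omega>\<close> in which a given word
  occurs is shift invariant, so ergodicity gives it measure 0 or 1 (\<open>occurs_zero_one\<close>); there are only
  countably many words, so almost every \<open>\<omega>\<close> has one and the same set of words, hence one and the same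
  spectrum. By the hypothesis on \<open>i\<close>, all words \<open>i\<dots>i\<close> belong to that common set.

  That words determine the spectrum rests on the criterion \<open>resolvent_iff_bounded_below\<close>: \<open>z\<close> is in the
  resolvent set iff \<open>\<parallel>u\<parallel> \<le> C \<parallel>(H - z) u\<parallel>\<close> for some \<open>C\<close> and all \<open>u\<close>. It is enough to test this bound on
  finitely supported \<open>u\<close>, and such a \<open>u\<close> sees only a finite word of \<open>\<omega>\<close>, so that it can be translated to
  wherever this word occurs in another sequence. The nontrivial half of the criterion is that a
  normal operator on a Hilbert space that is bounded below is invertible
  (\<open>normal_bounded_below_inverse\<close>).
\<close>

section \<open>Square-summable sequences on the integers\<close>

lemma ell2_bounded_sums:
  assumes "\<And>F. finite F \<Longrightarrow> (\<Sum>n\<in>F. (cmod (u n))\<^sup>2) \<le> C"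
  shows "u \<in> ell2"
  unfolding ell2_def mem_Collect_eq
  by (rule nonneg_bdd_above_summable_on) (auto intro!: bdd_aboveI2 assms)

lemma cmod_add_square_le: "(cmod (a + b))\<^sup>2 \<le> 2 * (cmod a)\<^sup>2 + 2 * (cmod b)\<^sup>2"
proof -
  have "(cmod (a + b))\<^sup>2 \<le> (cmod a + cmod b)\<^sup>2"
    by (intro power_mono norm_triangle_ineq) auto
  also have "\<dots> \<le> 2 * (cmod a)\<^sup>2 + 2 * (cmod b)\<^sup>2"
    using sum_squares_bound[of "cmod a" "cmod b"] by (simp add: power2_sum)
  finally show ?thesis .
qed

lemma ell2_add: "u \<in> ell2 \<Longrightarrow> w \<in> ell2 \<Longrightarrow> (\<lambda>n. u n + w n) \<in> ell2"
  unfolding ell2_def mem_Collect_eq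
  by (rule summable_on_comparison_test[where f="\<lambda>n. 2 * (cmod (u n))\<^sup>2 + 2 * (cmod (w n))\<^sup>2"])
     (auto intro!: summable_on_add summable_on_cmult_right cmod_add_square_le)

lemma ell2_mult_bounded:
  assumes "u \<in> ell2" "\<And>n. cmod (a n) \<le> M"
  shows "(\<lambda>n. a n * u n) \<in> ell2"
  unfolding ell2_def mem_Collect_eq
proof (rule summable_on_comparison_test[where f="\<lambda>n. M\<^sup>2 * (cmod (u n))\<^sup>2"])
  show "(\<lambda>n. M\<^sup>2 * (cmod (u n))\<^sup>2) summable_on UNIV"
    using assms(1) by (intro summable_on_cmult_right) (simp add: ell2_def)
  show "(cmod (a n * u n))\<^sup>2 \<le> M\<^sup>2 * (cmod (u n))\<^sup>2" for n
    using assms(2)[of n] by (auto simp: norm_mult power_mult_distrib intro!: mult_right_mono power_mono)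
qed auto

lemma ell2_scale: "u \<in> ell2 \<Longrightarrow> (\<lambda>n. c * u n) \<in> ell2"
  by (rule ell2_mult_bounded[where a="\<lambda>_. c" and M="cmod c"]) auto

lemma bij_int_translation: "bij (\<lambda>n::int. n + s)"
  by (rule bij_betw_byWitness[where f'="\<lambda>n. n - s"]) auto

lemma ell2_translate: "u \<in> ell2 \<Longrightarrow> (\<lambda>n. u (n + s)) \<in> ell2"
  using summable_on_reindex_bij_betw[OF bij_int_translation, of "\<lambda>n. (cmod (u n))\<^sup>2" s]
  by (simp add: ell2_def)

lemma ell2_norm_translate: "ell2_norm (\<lambda>n. u (n + s)) = ell2_norm u"
  using infsum_reindex_bij_betw[OF bij_int_translation, of "\<lambda>n. (cmod (u n))\<^sup>2" s]
  by (simp add: ell2_norm_def)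

lemma ell2_finite_support:
  assumes "finite F" "\<And>n. n \<notin> F \<Longrightarrow> u n = 0"
  shows "u \<in> ell2"
proof -
  have "(\<lambda>n. (cmod (u n))\<^sup>2) summable_on F" using assms(1) by simp
  also have "?this \<longleftrightarrow> (\<lambda>n. (cmod (u n))\<^sup>2) summable_on UNIV"
    by (rule summable_on_cong_neutral) (auto simp: assms)
  finally show ?thesis by (simp add: ell2_def)
qed

lemma ell2_norm_finite_support:
  assumes "finite F" "\<And>n. n \<notin> F \<Longrightarrow> u n = 0"
  shows "(ell2_norm u)\<^sup>2 = (\<Sum>n\<in>F. (cmod (u n))\<^sup>2)"
proof -
  have "(\<Sum>\<^sub>\<infinity>n. (cmod (u n))\<^sup>2) = (\<Sum>\<^sub>\<infinity>n\<in>F. (cmod (u n))\<^sup>2)"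
    by (rule infsum_cong_neutral) (auto simp: assms)
  then show ?thesis using assms(1) by (simp add: ell2_norm_def sum_nonneg)
qed

lemma summable_inner_ell2:
  assumes "u \<in> ell2" "w \<in> ell2"
  shows "(\<lambda>n. inner (u n) (w n)) summable_on UNIV"
proof (rule Infinite_Sum.abs_summable_summable, rule Infinite_Sum.abs_summable_on_comparison_test')
  show "(\<lambda>n. (cmod (u n))\<^sup>2 + (cmod (w n))\<^sup>2) summable_on UNIV"
    using assms by (intro summable_on_add) (auto simp: ell2_def)
  show "norm (inner (u n) (w n)) \<le> (cmod (u n))\<^sup>2 + (cmod (w n))\<^sup>2" for n
    using Cauchy_Schwarz_ineq2[of "u n" "w n"] sum_squares_bound[of "cmod (u n)" "cmod (w n)"]
      zero_le_power2[of "cmod (u n)"] zero_le_power2[of "cmod (w n)"] mult_nonneg_nonneg[of "cmod (u n)" "cmod (w n)"]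
    by (simp del: zero_le_power2)
qed

section \<open>The Hilbert space of square-summable sequences\<close>

text \<open>
  The Hilbert space is taken over the reals, with the real part of the complex inner product. This does
  not change the norm, and the adjoint of a complex linear operator is the same for both inner products.
\<close>

typedef l2 = ell2 morphisms seq Abs_l2
  by (rule exI[of _ "\<lambda>_. 0"]) (simp add: ell2_def)

setup_lifting type_definition_l2

instantiation l2 :: real_vector
begin

lift_definition zero_l2 :: l2 is "\<lambda>_. 0" by (simp add: ell2_def)
lift_definition plus_l2 :: "l2 \<Rightarrow> l2 \<Rightarrow> l2" is "\<lambda>u w n. u n + w n" by (rule ell2_add)
lift_definition uminus_l2 :: "l2 \<Rightarrow> l2" is "\<lambda>u n. - u n" by (simp add: ell2_def)
lift_definition minus_l2 :: "l2 \<Rightarrow> l2 \<Rightarrow> l2" is "\<lambda>u w n. u n - w n"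
  using ell2_add[of _ "\<lambda>n. - _ n"] by (simp add: ell2_def)
lift_definition scaleR_l2 :: "real \<Rightarrow> l2 \<Rightarrow> l2" is "\<lambda>r u n. r *\<^sub>R u n"
  by (simp add: scaleR_conv_of_real ell2_scale)

instance
  by standard (transfer; simp add: algebra_simps)+

end

instantiation l2 :: real_inner
begin

lift_definition inner_l2 :: "l2 \<Rightarrow> l2 \<Rightarrow> real" is "\<lambda>u w. \<Sum>\<^sub>\<infinity>n. inner (u n) (w n)" .

definition norm_l2 :: "l2 \<Rightarrow> real" where "norm_l2 x = sqrt (inner x x)"
definition dist_l2 :: "l2 \<Rightarrow> l2 \<Rightarrow> real" where "dist_l2 x y = norm (x - y)"
definition sgn_l2 :: "l2 \<Rightarrow> l2" where "sgn_l2 x = x /\<^sub>R norm x"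
definition uniformity_l2 :: "(l2 \<times> l2) filter"
  where "uniformity_l2 = (INF e\<in>{0 <..}. principal {(x, y). dist x y < e})"
definition open_l2 :: "l2 set \<Rightarrow> bool"
  where "open_l2 U \<longleftrightarrow> (\<forall>x\<in>U. eventually (\<lambda>(x', y). x' = x \<longrightarrow> y \<in> U) uniformity)"

instance
proof
  fix x y z :: l2 and r :: real and U :: "l2 set"
  show "inner x y = inner y x" by transfer (simp add: inner_commute)
  show "inner (x + y) z = inner x z + inner y z"
    by transfer (simp add: inner_add_left infsum_add summable_inner_ell2)
  show "inner (r *\<^sub>R x) y = r * inner x y"
    by transfer (simp add: infsum_cmult_right')
  show "0 \<le> inner x x" by transfer (simp add: infsum_nonneg)
  show "inner x x = 0 \<longleftrightarrow> x = 0"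
  proof
    assume "inner x x = 0"
    then have "seq x = (\<lambda>_. 0)"
    proof (transfer, intro ext)
      fix u :: "int \<Rightarrow> complex" and n
      assume u: "u \<in> ell2" and eq: "(\<Sum>\<^sub>\<infinity>n. inner (u n) (u n)) = 0"
      have "(\<Sum>m\<in>{n}. inner (u m) (u m)) \<le> (\<Sum>\<^sub>\<infinity>n. inner (u n) (u n))"
        by (rule finite_sum_le_infsum) (auto simp: u summable_inner_ell2)
      then show "u n = 0" using eq by (simp add: power2_norm_eq_inner[symmetric])
    qed
    then show "x = 0" by transfer
  qed (transfer, simp)
  show "norm x = sqrt (inner x x)" by (rule norm_l2_def)
  show "dist x y = norm (x - y)" by (rule dist_l2_def)
  show "sgn x = x /\<^sub>R norm x" by (rule sgn_l2_def)
  show "(uniformity :: (l2 \<times> l2) filter) = (INF e\<in>{0 <..}. principal {(x, y). dist x y < e})"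
    by (rule uniformity_l2_def)
  show "open U \<longleftrightarrow> (\<forall>x\<in>U. eventually (\<lambda>(x', y). x' = x \<longrightarrow> y \<in> U) uniformity)"
    by (rule open_l2_def)
qed

end

lemma norm_l2_eq: "norm x = ell2_norm (seq x)"
  by (simp add: norm_l2_def inner_l2.rep_eq ell2_norm_def power2_norm_eq_inner)

lemma seq_in_ell2 [simp]: "seq x \<in> ell2"
  by (rule seq)

lemma norm_square_l2: "(norm x)\<^sup>2 = (\<Sum>\<^sub>\<infinity>n. (cmod (seq x n))\<^sup>2)"
  by (simp add: norm_l2_eq ell2_norm_def infsum_nonneg)

lemma sum_le_norm_l2: "finite F \<Longrightarrow> (\<Sum>n\<in>F. (cmod (seq x n))\<^sup>2) \<le> (norm x)\<^sup>2"
  unfolding norm_square_l2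
  by (rule finite_sum_le_infsum) (use seq_in_ell2[of x] in \<open>auto simp: ell2_def\<close>)

lemma norm_l2_le:
  assumes "0 \<le> C" "\<And>F. finite F \<Longrightarrow> (\<Sum>n\<in>F. (cmod (seq x n))\<^sup>2) \<le> C\<^sup>2"
  shows "norm x \<le> C"
proof (rule power2_le_imp_le[OF _ assms(1)])
  show "(norm x)\<^sup>2 \<le> C\<^sup>2"
    unfolding norm_square_l2
    by (rule infsum_le_finite_sums) (use seq_in_ell2[of x] assms(2) in \<open>auto simp: ell2_def\<close>)
qed

lemma cmod_seq_le: "cmod (seq x n) \<le> norm x"
  by (rule power2_le_imp_le) (use sum_le_norm_l2[of "{n}" x] in auto)

text \<open>
  A Cauchy sequence converges at every site. The limit is the limit in norm because each finite partial
  sum of squares satisfies the Cauchy estimate in the limit, uniformly in the finite set.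
\<close>

instance l2 :: complete_space
proof
  fix X :: "nat \<Rightarrow> l2"
  assume X: "Cauchy X"
  have "\<exists>l. (\<lambda>m. seq (X m) n) \<longlonglongrightarrow> l" for n
  proof -
    have "Cauchy (\<lambda>m. seq (X m) n)"
    proof (rule metric_CauchyI)
      fix e :: real assume "0 < e"
      then obtain M where "\<And>m k. M \<le> m \<Longrightarrow> M \<le> k \<Longrightarrow> dist (X m) (X k) < e"
        using metric_CauchyD[OF X] by blast
      then show "\<exists>M. \<forall>m\<ge>M. \<forall>k\<ge>M. dist (seq (X m) n) (seq (X k) n) < e"
        by (metis cmod_seq_le dist_norm le_less_trans minus_l2.rep_eq)
    qed
    then show ?thesis by (simp add: Cauchy_convergent_iff convergent_def)
  qed
  then obtain u where u: "\<And>n. (\<lambda>m. seq (X m) n) \<longlonglongrightarrow> u n" by metis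
  \<comment> \<open>a Cauchy bound passes to the pointwise limit on every finite set of sites\<close>
  have fatou: "(\<Sum>n\<in>F. (cmod (seq (X m) n - u n))\<^sup>2) \<le> e\<^sup>2"
    if "finite F" "\<And>m k. M \<le> m \<Longrightarrow> M \<le> k \<Longrightarrow> dist (X m) (X k) < e" "M \<le> m" for F e M m
  proof (rule LIMSEQ_le_const2)
    show "(\<lambda>k. \<Sum>n\<in>F. (cmod (seq (X m) n - seq (X k) n))\<^sup>2)
        \<longlonglongrightarrow> (\<Sum>n\<in>F. (cmod (seq (X m) n - u n))\<^sup>2)"
      by (intro tendsto_intros u)
    have "(\<Sum>n\<in>F. (cmod (seq (X m) n - seq (X k) n))\<^sup>2) \<le> e\<^sup>2" if "M \<le> k" for k
    proof -
      have "(\<Sum>n\<in>F. (cmod (seq (X m) n - seq (X k) n))\<^sup>2) \<le> (norm (X m - X k))\<^sup>2"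
        using sum_le_norm_l2[OF \<open>finite F\<close>, of "X m - X k"] by (simp add: minus_l2.rep_eq)
      also have "\<dots> \<le> e\<^sup>2"
        using \<open>\<And>m k. M \<le> m \<Longrightarrow> M \<le> k \<Longrightarrow> dist (X m) (X k) < e\<close>[OF \<open>M \<le> m\<close> \<open>M \<le> k\<close>]
        by (intro power_mono) (auto simp: dist_norm)
      finally show ?thesis .
    qed
    then show "\<exists>N. \<forall>k\<ge>N. (\<Sum>n\<in>F. (cmod (seq (X m) n - seq (X k) n))\<^sup>2) \<le> e\<^sup>2" by blast
  qed
  obtain M where M: "\<And>m k. M \<le> m \<Longrightarrow> M \<le> k \<Longrightarrow> dist (X m) (X k) < 1"
    using metric_CauchyD[OF X zero_less_one] by blast
  have "(\<lambda>n. seq (X M) n - u n) \<in> ell2"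
    by (rule ell2_bounded_sums[of _ "1\<^sup>2"]) (rule fatou[OF _ M], auto)
  then have "(\<lambda>n. seq (X M) n + (- 1) * (seq (X M) n - u n)) \<in> ell2"
    by (intro ell2_add ell2_scale) auto
  then have "u \<in> ell2" by simp
  then obtain x where x: "seq x = u" using Abs_l2_inverse by blast
  have "X \<longlonglongrightarrow> x"
  proof (rule metric_LIMSEQ_I)
    fix e :: real assume e: "0 < e"
    then obtain M where M: "\<And>m k. M \<le> m \<Longrightarrow> M \<le> k \<Longrightarrow> dist (X m) (X k) < e / 2"
      using metric_CauchyD[OF X, of "e / 2"] by auto
    have "norm (X m - x) \<le> e / 2" if "M \<le> m" for m
      by (rule norm_l2_le) (use e fatou[OF _ M that] in \<open>auto simp: minus_l2.rep_eq x\<close>)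
    then show "\<exists>N. \<forall>m\<ge>N. dist (X m) x < e"
      using e by (force simp: dist_norm)
  qed
  then show "convergent X" by (rule convergentI)
qed

section \<open>Normal operators that are bounded below\<close>

text \<open>
  Injectivity is clear and surjectivity is the point. Since \<open>\<parallel>B w\<parallel> = \<parallel>A w\<parallel>\<close> for normal \<open>A\<close> with adjoint \<open>B\<close>,
  the operator \<open>B\<close> is injective too, so \<open>A x = y\<close> follows from \<open>B (A x - y) = 0\<close>. The latter is solved by a
  fixed point of \<open>x \<mapsto> x - t B (A x - y)\<close>, a contraction for small \<open>t\<close> because \<open>B A\<close> is positive and bounded
  away from zero.
\<close>

lemma normal_bounded_below_inverse:
  fixes A B :: "'a :: {real_inner, complete_space} \<Rightarrow> 'a"
  assumes A: "bounded_linear A" and B: "bounded_linear B"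
    and adj: "\<And>x y. inner (A x) y = inner x (B y)"
    and normal: "\<And>x. A (B x) = B (A x)"
    and below: "\<And>x. norm x \<le> C * norm (A x)"
  obtains R where "bounded_linear R" "\<And>x. R (A x) = x" "\<And>x. A (R x) = x"
proof -
  interpret A: bounded_linear A by fact
  interpret B: bounded_linear B by fact
  obtain M where M: "M > 0" "\<And>x. norm (B x) \<le> norm x * M" using B.pos_bounded by blast
  \<comment> \<open>enlarging \<open>C\<close> to \<open>K\<close> yields \<open>K M \<ge> 1\<close>, so that the contraction factor \<open>q\<close> is a real number\<close>
  define K where "K = max C (1 / M)"
  have "1 / M \<le> K" by (simp add: K_def)
  then have K: "K > 0" "1 \<le> K * M"
    using M(1) by (auto simp: pos_divide_le_eq intro: less_le_trans[of 0 "1 / M"])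
  have belowK: "norm x \<le> K * norm (A x)" for x
    using below[of x] mult_right_mono[of C K "norm (A x)"] by (simp add: K_def)
  have norm_eq: "norm (B x) = norm (A x)" for x
  proof -
    have "inner (B x) (B x) = inner (A x) (A x)"
      by (metis adj inner_commute normal)
    then show ?thesis by (simp add: norm_eq_sqrt_inner)
  qed
  have inj: "x = 0" if "A x = 0" for x using below[of x] that by simp
  have surj: "\<exists>x. A x = y" for y
  proof -
    define q where "q = sqrt (1 - 1 / (K\<^sup>2 * M\<^sup>2))"
    have "1 \<le> K\<^sup>2 * M\<^sup>2" using K(2) by (metis one_le_power power_mult_distrib)
    then have q: "0 \<le> q" "q < 1" "q\<^sup>2 = 1 - 1 / (K\<^sup>2 * M\<^sup>2)"
      using K(1) M(1) by (auto simp: q_def)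
    \<comment> \<open>with the step \<open>1 / M\<^sup>2\<close> the quadratic error uses up only half of the linear gain\<close>
    have contraction: "norm (x - (1 / M\<^sup>2) *\<^sub>R B (A x)) \<le> q * norm x" for x
    proof (rule power2_le_imp_le)
      have ip: "inner x (B (A x)) = (norm (A x))\<^sup>2" by (simp add: adj[symmetric] power2_norm_eq_inner)
      have "(norm (x - (1 / M\<^sup>2) *\<^sub>R B (A x)))\<^sup>2
          = (norm x)\<^sup>2 - 2 / M\<^sup>2 * inner x (B (A x)) + (1 / M\<^sup>2)\<^sup>2 * (norm (B (A x)))\<^sup>2"
        unfolding power2_norm_eq_inner
        by (simp add: inner_diff_left inner_diff_right inner_commute power2_eq_square)
      also have "\<dots> = (norm x)\<^sup>2 - 2 / M\<^sup>2 * (norm (A x))\<^sup>2 + (1 / M\<^sup>2)\<^sup>2 * (norm (B (A x)))\<^sup>2"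
        by (simp only: ip)
      also have "\<dots> \<le> (norm x)\<^sup>2 - 2 / M\<^sup>2 * (norm (A x))\<^sup>2 + (1 / M\<^sup>2)\<^sup>2 * (norm (A x) * M)\<^sup>2"
        by (intro add_left_mono mult_left_mono power_mono M) auto
      also have "\<dots> = (norm x)\<^sup>2 - (norm (A x))\<^sup>2 / M\<^sup>2"
        using M(1) by (simp add: field_simps power2_eq_square)
      also have "\<dots> \<le> (norm x)\<^sup>2 - (norm x / K)\<^sup>2 / M\<^sup>2"
        using belowK[of x] K M(1) by (intro diff_left_mono divide_right_mono power_mono) (auto simp: field_simps)
      also have "\<dots> = (q * norm x)\<^sup>2"
        by (simp add: power_mult_distrib q(3) field_simps power_divide)
      finally show "(norm (x - (1 / M\<^sup>2) *\<^sub>R B (A x)))\<^sup>2 \<le> (q * norm x)\<^sup>2" .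
    qed (use q in simp)
    define f where "f x = x - (1 / M\<^sup>2) *\<^sub>R B (A x - y)" for x
    have "f x - f x' = (x - x') - (1 / M\<^sup>2) *\<^sub>R B (A (x - x'))" for x x'
      by (simp add: f_def A.diff B.diff algebra_simps)
    then have "dist (f x) (f x') \<le> q * dist x x'" for x x'
      using contraction[of "x - x'"] by (simp add: dist_norm)
    then obtain x where "f x = x" using banach_fix_type[OF q(1,2)] by metis
    then have "B (A x - y) = 0" using M(1) by (simp add: f_def)
    then have "A (A x - y) = 0" using norm_eq[of "A x - y"] by simp
    then have "A x - y = 0" by (rule inj)
    then show ?thesis by (intro exI[of _ x]) simp
  qed
  then obtain R where AR: "\<And>y. A (R y) = y" by metis
  have RA: "R (A x) = x" for x
    using inj[of "R (A x) - x"] AR[of "A x"] by (simp add: A.diff)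
  have "bounded_linear R"
  proof (rule bounded_linear_intro)
    show "R (x + y) = R x + R y" for x y by (metis A.add AR RA)
    show "R (r *\<^sub>R x) = r *\<^sub>R R x" for r x by (metis A.scaleR AR RA)
    show "norm (R x) \<le> norm x * C" for x using below[of "R x"] by (simp add: AR mult.commute)
  qed
  then show ?thesis using RA AR that by blast
qed

section \<open>Schroedinger operators on the Hilbert space\<close>

lift_definition translate :: "int \<Rightarrow> l2 \<Rightarrow> l2" is "\<lambda>s u n. u (n + s)"
  by (rule ell2_translate)

text \<open>Meaningful for bounded \<open>a\<close> only; otherwise the product may leave \<^const>\<open>ell2\<close>.\<close>

definition multiply :: "(int \<Rightarrow> complex) \<Rightarrow> l2 \<Rightarrow> l2" where
  "multiply a x = Abs_l2 (\<lambda>n. a n * seq x n)"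

lemma seq_multiply: "(\<And>n. cmod (a n) \<le> M) \<Longrightarrow> seq (multiply a x) = (\<lambda>n. a n * seq x n)"
  unfolding multiply_def by (intro Abs_l2_inverse ell2_mult_bounded[of _ a M]) auto

lemma l2_eqI: "(\<And>n. seq x n = seq y n) \<Longrightarrow> x = y"
  by (metis seq_inject ext)

lemma bounded_linear_translate: "bounded_linear (translate s)"
proof (rule bounded_linear_intro)
  show "norm (translate s x) \<le> norm x * 1" for x
    by (simp add: norm_l2_eq translate.rep_eq ell2_norm_translate)
qed (transfer; simp)+

lemma bounded_linear_multiply:
  assumes "\<And>n. cmod (a n) \<le> M"
  shows "bounded_linear (multiply a)"
proof (rule bounded_linear_intro)
  note seq = seq_multiply[of a M, OF assms]
  show "multiply a (x + y) = multiply a x + multiply a y" for x y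
    by (rule l2_eqI) (simp add: seq plus_l2.rep_eq algebra_simps)
  show "multiply a (r *\<^sub>R x) = r *\<^sub>R multiply a x" for r x
    by (rule l2_eqI) (simp add: seq scaleR_l2.rep_eq)
  have M: "0 \<le> M" using assms[of 0] norm_ge_zero order_trans by blast
  show "norm (multiply a x) \<le> norm x * M" for x
  proof (rule norm_l2_le)
    fix F :: "int set" assume F: "finite F"
    have "(\<Sum>n\<in>F. (cmod (seq (multiply a x) n))\<^sup>2) \<le> (\<Sum>n\<in>F. M\<^sup>2 * (cmod (seq x n))\<^sup>2)"
      unfolding seq norm_mult power_mult_distrib
      by (intro sum_mono mult_right_mono power_mono assms) auto
    also have "\<dots> \<le> M\<^sup>2 * (norm x)\<^sup>2"
      by (simp add: sum_distrib_left[symmetric] mult_left_mono sum_le_norm_l2[OF F])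
    finally show "(\<Sum>n\<in>F. (cmod (seq (multiply a x) n))\<^sup>2) \<le> (norm x * M)\<^sup>2"
      by (simp add: power_mult_distrib mult.commute)
  qed (use M in simp)
qed

lemma inner_translate: "inner (translate s x) y = inner x (translate (- s) y)"
proof transfer
  fix s and u w :: "int \<Rightarrow> complex"
  show "(\<Sum>\<^sub>\<infinity>n. inner (u (n + s)) (w n)) = (\<Sum>\<^sub>\<infinity>n. inner (u n) (w (n + - s)))"
    using infsum_reindex_bij_betw[OF bij_int_translation, of "\<lambda>n. inner (u n) (w (n + - s))" s]
    by simp
qed

lemma inner_multiply:
  assumes "\<And>n. cmod (a n) \<le> M"
  shows "inner (multiply a x) y = inner x (multiply (\<lambda>n. cnj (a n)) y)"
  unfolding inner_l2.rep_eq seq_multiply[of a M, OF assms]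
  by (subst seq_multiply[of _ M]) (auto simp: assms inner_complex_def algebra_simps intro!: infsum_cong)

definition schroedinger_minus :: "(nat \<Rightarrow> real) \<Rightarrow> (int \<Rightarrow> nat) \<Rightarrow> complex \<Rightarrow> l2 \<Rightarrow> l2" where
  "schroedinger_minus v \<omega> z x =
     translate 1 x + translate (- 1) x + multiply (\<lambda>n. complex_of_real (v (\<omega> n)) - z) x"

lemma potential_bounded:
  assumes "finite (range \<omega>)"
  obtains M where "\<And>n. cmod (complex_of_real (v (\<omega> n)) - z) \<le> M"
proof -
  have "finite ((\<lambda>a. cmod (complex_of_real (v a) - z)) ` range \<omega>)" using assms by blast
  then have "bdd_above ((\<lambda>a. cmod (complex_of_real (v a) - z)) ` range \<omega>)" by (rule bdd_above_finite)
  then show ?thesis using that by (auto simp: bdd_above_def)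
qed

lemma seq_schroedinger_minus:
  assumes "finite (range \<omega>)"
  shows "seq (schroedinger_minus v \<omega> z x) = (\<lambda>n. schroedinger v \<omega> (seq x) n - z * seq x n)"
proof -
  obtain M where "\<And>n. cmod (complex_of_real (v (\<omega> n)) - z) \<le> M"
    using potential_bounded[OF assms] by blast
  from seq_multiply[OF this] show ?thesis
    by (simp add: schroedinger_minus_def plus_l2.rep_eq translate.rep_eq schroedinger_def
        algebra_simps fun_eq_iff)
qed

lemma bounded_linear_schroedinger_minus:
  assumes "finite (range \<omega>)"
  shows "bounded_linear (schroedinger_minus v \<omega> z)"
proof -
  obtain M where "\<And>n. cmod (complex_of_real (v (\<omega> n)) - z) \<le> M"
    using potential_bounded[OF assms] by blast
  then show ?thesis unfolding schroedinger_minus_def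
    by (intro bounded_linear_add bounded_linear_translate bounded_linear_multiply)
qed

lemma inner_schroedinger_minus:
  assumes "finite (range \<omega>)"
  shows "inner (schroedinger_minus v \<omega> z x) y = inner x (schroedinger_minus v \<omega> (cnj z) y)"
proof -
  obtain M where "\<And>n. cmod (complex_of_real (v (\<omega> n)) - z) \<le> M"
    using potential_bounded[OF assms] by blast
  from inner_multiply[OF this] show ?thesis
    unfolding schroedinger_minus_def
    by (simp add: inner_add_left inner_add_right inner_translate)
qed

lemma schroedinger_minus_commute:
  assumes "finite (range \<omega>)"
  shows "schroedinger_minus v \<omega> z (schroedinger_minus v \<omega> z' x)
       = schroedinger_minus v \<omega> z' (schroedinger_minus v \<omega> z x)"
  by (rule l2_eqI) (simp add: seq_schroedinger_minus[OF assms] schroedinger_def algebra_simps)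

section \<open>The resolvent set and bounds from below\<close>

definition lower_bound_at :: "(nat \<Rightarrow> real) \<Rightarrow> (int \<Rightarrow> nat) \<Rightarrow> complex \<Rightarrow> real \<Rightarrow> (int \<Rightarrow> complex) \<Rightarrow> bool" where
  "lower_bound_at v \<omega> z C u \<longleftrightarrow>
     ell2_norm u \<le> C * ell2_norm (\<lambda>n. schroedinger v \<omega> u n - z * u n)"

lemma lower_bound_at_seq:
  "finite (range \<omega>) \<Longrightarrow> lower_bound_at v \<omega> z C (seq x) \<longleftrightarrow> norm x \<le> C * norm (schroedinger_minus v \<omega> z x)"
  by (simp add: lower_bound_at_def norm_l2_eq seq_schroedinger_minus)

text \<open>
  The operator with the conjugate energy is the adjoint of \<open>H - z\<close> and commutes with it, so \<open>H - z\<close> is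
  normal and a bound from below produces a bounded real-linear inverse. This inverse is complex linear
  because \<open>H - z\<close> is.
\<close>

lemma resolvent_iff_bounded_below:
  assumes fin: "finite (range \<omega>)"
  shows "z \<in> resolvent_set (schroedinger v \<omega>) \<longleftrightarrow> (\<exists>C. \<forall>u\<in>ell2. lower_bound_at v \<omega> z C u)"
proof
  assume "z \<in> resolvent_set (schroedinger v \<omega>)"
  then obtain R where R: "bounded_op R" "\<forall>u\<in>ell2. R (\<lambda>n. schroedinger v \<omega> u n - z * u n) = u"
    unfolding resolvent_set_def by blast
  then obtain C where C: "\<And>u. u \<in> ell2 \<Longrightarrow> ell2_norm (R u) \<le> C * ell2_norm u"
    unfolding bounded_op_def by blast
  have "lower_bound_at v \<omega> z C u" if "u \<in> ell2" for u
  proof -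
    have "(\<lambda>n. schroedinger v \<omega> u n - z * u n) \<in> ell2"
      using seq_schroedinger_minus[OF fin, of v z "Abs_l2 u"] seq_in_ell2 by (metis Abs_l2_inverse that)
    from C[OF this] show ?thesis using R(2) that by (simp add: lower_bound_at_def)
  qed
  then show "\<exists>C. \<forall>u\<in>ell2. lower_bound_at v \<omega> z C u" by blast
next
  assume "\<exists>C. \<forall>u\<in>ell2. lower_bound_at v \<omega> z C u"
  then obtain C where C: "\<And>u. u \<in> ell2 \<Longrightarrow> lower_bound_at v \<omega> z C u" by blast
  let ?D = "schroedinger_minus v \<omega> z"
  obtain R where R: "bounded_linear R" and RD: "\<And>x. R (?D x) = x" and DR: "\<And>x. ?D (R x) = x"
    by (rule normal_bounded_below_inverse[of ?D "schroedinger_minus v \<omega> (cnj z)" C])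
       (use C[OF seq_in_ell2] in \<open>auto intro: bounded_linear_schroedinger_minus
         inner_schroedinger_minus schroedinger_minus_commute simp: fin lower_bound_at_seq[OF fin]\<close>)
  interpret R: bounded_linear R by fact
  define S where "S u = seq (R (Abs_l2 u))" for u
  have D: "?D x = Abs_l2 (\<lambda>n. schroedinger v \<omega> (seq x) n - z * seq x n)" for x
    by (simp add: seq_schroedinger_minus[OF fin, symmetric] seq_inverse)
  have DR': "(\<lambda>n. schroedinger v \<omega> (seq (R x)) n - z * seq (R x) n) = seq x" for x
    using DR[of x] seq_schroedinger_minus[OF fin] by metis
  have "bounded_op S"
    unfolding bounded_op_def
  proof (intro conjI ballI allI)
    show "S \<in> ell2 \<rightarrow> ell2" by (simp add: S_def)
    show "S (\<lambda>n. u n + w n) = (\<lambda>n. S u n + S w n)" if "u \<in> ell2" "w \<in> ell2" for u w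
    proof -
      have "Abs_l2 (\<lambda>n. u n + w n) = Abs_l2 u + Abs_l2 w"
        by (rule l2_eqI) (simp add: plus_l2.rep_eq Abs_l2_inverse that ell2_add)
      then show ?thesis by (simp add: S_def R.add plus_l2.rep_eq)
    qed
    show "S (\<lambda>n. c * u n) = (\<lambda>n. c * S u n)" if "u \<in> ell2" for c u
    proof -
      have cS: "(\<lambda>n. c * S u n) \<in> ell2" by (simp add: S_def ell2_scale)
      have "?D (Abs_l2 (\<lambda>n. c * S u n)) = Abs_l2 (\<lambda>n. c * u n)"
      proof (rule l2_eqI)
        fix n
        have "schroedinger v \<omega> (\<lambda>n. c * S u n) n - z * (c * S u n)
            = c * (schroedinger v \<omega> (S u) n - z * S u n)"
          by (simp add: schroedinger_def algebra_simps)
        also have "schroedinger v \<omega> (S u) n - z * S u n = u n"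
          using fun_cong[OF DR'[of "Abs_l2 u"], of n] by (simp add: S_def Abs_l2_inverse that)
        finally show "seq (?D (Abs_l2 (\<lambda>n. c * S u n))) n = seq (Abs_l2 (\<lambda>n. c * u n)) n"
          by (simp add: seq_schroedinger_minus[OF fin] Abs_l2_inverse[OF cS]
              Abs_l2_inverse[OF ell2_scale[OF that]])
      qed
      then show ?thesis using RD[of "Abs_l2 (\<lambda>n. c * S u n)"] by (simp add: S_def Abs_l2_inverse[OF cS[unfolded S_def]])
    qed
    obtain K where "\<And>x. norm (R x) \<le> norm x * K" using R.bounded by blast
    then have "ell2_norm (S u) \<le> K * ell2_norm u" if "u \<in> ell2" for u
      unfolding S_def using that by (metis Abs_l2_inverse mult.commute norm_l2_eq)
    then show "\<exists>C. \<forall>u\<in>ell2. ell2_norm (S u) \<le> C * ell2_norm u" by blast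
  qed
  moreover have "S (\<lambda>n. schroedinger v \<omega> u n - z * u n) = u" if "u \<in> ell2" for u
    using RD[of "Abs_l2 u"] by (simp add: S_def D Abs_l2_inverse that)
  moreover have "(\<lambda>n. schroedinger v \<omega> (S u) n - z * S u n) = u" if "u \<in> ell2" for u
    using DR'[of "Abs_l2 u"] by (simp add: S_def Abs_l2_inverse that)
  ultimately show "z \<in> resolvent_set (schroedinger v \<omega>)"
    unfolding resolvent_set_def by blast
qed

section \<open>The spectrum depends only on the words that occur\<close>

lemma truncation_tendsto:
  "((\<lambda>F. multiply (indicator F) x) \<longlongrightarrow> x) (finite_subsets_at_top UNIV)"
proof -
  let ?f = "\<lambda>n. (cmod (seq x n))\<^sup>2"
  have summable: "?f summable_on UNIV" using seq_in_ell2[of x] by (simp add: ell2_def)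
  have seq: "seq (multiply (indicator F) x) = (\<lambda>n. indicator F n * seq x n)" for F
    by (rule seq_multiply[of _ 1]) (simp add: indicator_def)
  have dist: "dist (multiply (indicator F) x) x = sqrt (infsum ?f UNIV - sum ?f F)" if "finite F" for F
  proof -
    have "(norm (x - multiply (indicator F) x))\<^sup>2 = infsum ?f (UNIV - F)"
      unfolding norm_square_l2
      by (rule infsum_cong_neutral) (auto simp: minus_l2.rep_eq seq)
    also have "\<dots> = infsum ?f UNIV - sum ?f F"
      using infsum_Diff[of ?f UNIV F] summable that by simp
    finally show ?thesis by (metis dist_commute dist_norm norm_ge_zero real_sqrt_unique)
  qed
  have "((\<lambda>F. sqrt (infsum ?f UNIV - sum ?f F)) \<longlongrightarrow> sqrt (infsum ?f UNIV - infsum ?f UNIV))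
      (finite_subsets_at_top UNIV)"
    by (intro tendsto_intros infsum_tendsto summable)
  then have "((\<lambda>F. sqrt (infsum ?f UNIV - sum ?f F)) \<longlongrightarrow> 0) (finite_subsets_at_top UNIV)"
    by simp
  then have "((\<lambda>F. dist (multiply (indicator F) x) x) \<longlongrightarrow> 0) (finite_subsets_at_top UNIV)"
    by (rule Lim_transform_eventually)
       (auto simp: dist intro: eventually_finite_subsets_at_top_weakI)
  then show ?thesis by (rule tendsto_dist_iff[THEN iffD2])
qed

text \<open>
  Truncations converge in norm and \<open>H - z\<close> is continuous, so the bound passes to the limit.
\<close>

lemma lower_bound_at_if_finite_support:
  assumes fin: "finite (range \<omega>)"
    and local: "\<And>u. finite {n. u n \<noteq> 0} \<Longrightarrow> lower_bound_at v \<omega> z C u"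
    and u: "u \<in> ell2"
  shows "lower_bound_at v \<omega> z C u"
proof -
  define x where "x = Abs_l2 u"
  let ?D = "schroedinger_minus v \<omega> z"
  have "norm x \<le> C * norm (?D x)"
  proof (rule tendsto_le)
    show "((\<lambda>F. norm (multiply (indicator F) x)) \<longlongrightarrow> norm x) (finite_subsets_at_top UNIV)"
      by (intro tendsto_norm truncation_tendsto)
    show "((\<lambda>F. C * norm (?D (multiply (indicator F) x))) \<longlongrightarrow> C * norm (?D x))
        (finite_subsets_at_top UNIV)"
      by (intro tendsto_intros bounded_linear.tendsto[OF bounded_linear_schroedinger_minus[OF fin]]
          truncation_tendsto)
    have "norm (multiply (indicator F) x) \<le> C * norm (?D (multiply (indicator F) x))"
      if "finite F" for F
    proof -
      have "seq (multiply (indicator F) x) = (\<lambda>n. indicator F n * seq x n)"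
        by (rule seq_multiply[of _ 1]) (simp add: indicator_def)
      then have "finite {n. seq (multiply (indicator F) x) n \<noteq> 0}"
        using that by (auto simp: indicator_def)
      from local[OF this] show ?thesis by (simp add: lower_bound_at_seq[OF fin])
    qed
    then show "\<forall>\<^sub>F F in finite_subsets_at_top UNIV.
        norm (multiply (indicator F) x) \<le> C * norm (?D (multiply (indicator F) x))"
      by (auto intro: eventually_finite_subsets_at_top_weakI)
  qed simp
  then show ?thesis using lower_bound_at_seq[OF fin, of v z C x] by (simp add: x_def Abs_l2_inverse u)
qed

definition occurs :: "'a list \<Rightarrow> (int \<Rightarrow> 'a) \<Rightarrow> bool" where
  "occurs w \<omega> \<longleftrightarrow> (\<exists>s. \<forall>j<length w. \<omega> (s + int j) = w ! j)"

text \<open>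
  A finite set of sites lies in an interval, and the values of \<open>\<omega>\<close> on an interval form a word.
\<close>

lemma same_words_locally_translate:
  assumes "\<And>w. occurs w \<omega> \<Longrightarrow> occurs w \<omega>'" "finite F"
  shows "\<exists>s. \<forall>n\<in>F. \<omega>' (n + s) = \<omega> n"
proof -
  obtain m where m: "F \<subseteq> {- int m .. int m}"
  proof -
    have "\<bar>n\<bar> \<le> Max (abs ` insert 0 F)" if "n \<in> F" for n
      using that \<open>finite F\<close> by (intro Max_ge) auto
    then show thesis by (intro that[of "nat (Max (abs ` insert 0 F))"]) force
  qed
  define w where "w = map (\<lambda>j. \<omega> (- int m + int j)) [0..<2 * m + 1]"
  have "occurs w \<omega>" unfolding occurs_def
    by (rule exI[of _ "- int m"]) (auto simp: w_def simp del: upt_Suc)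
  then obtain t where t: "\<And>j. j < 2 * m + 1 \<Longrightarrow> \<omega>' (t + int j) = \<omega> (- int m + int j)"
    using assms(1)[of w] unfolding occurs_def by (auto simp: w_def simp del: upt_Suc)
  show ?thesis
  proof (intro exI ballI)
    fix n assume "n \<in> F"
    then have "- int m \<le> n" "n \<le> int m" using m by auto
    then show "\<omega>' (n + (t + int m)) = \<omega> n" using t[of "nat (n + int m)"] by (simp add: algebra_simps)
  qed
qed

text \<open>
  A finitely supported \<open>u\<close> meets the potential only on its support. Moving it to a place where \<open>\<omega>'\<close> repeats
  the values of \<open>\<omega>\<close> on that support turns the bound for \<open>\<omega>'\<close> into the bound for \<open>\<omega>\<close> with the same constant.
\<close>

lemma resolvent_set_mono_words:
  assumes fin: "finite (range \<omega>)" "finite (range \<omega>')"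
    and words: "\<And>w. occurs w \<omega> \<Longrightarrow> occurs w \<omega>'"
  shows "resolvent_set (schroedinger v \<omega>') \<subseteq> resolvent_set (schroedinger v \<omega>)"
proof
  fix z assume "z \<in> resolvent_set (schroedinger v \<omega>')"
  then obtain C where C: "\<And>u. u \<in> ell2 \<Longrightarrow> lower_bound_at v \<omega>' z C u"
    unfolding resolvent_iff_bounded_below[OF fin(2)] by blast
  have "lower_bound_at v \<omega> z C u" if F: "finite {n. u n \<noteq> 0}" for u
  proof -
    obtain s where s: "\<forall>n\<in>{n. u n \<noteq> 0}. \<omega>' (n + s) = \<omega> n"
      using same_words_locally_translate[OF words F] by metis
    define u' where "u' n = u (n - s)" for n
    have "u \<in> ell2" using F by (rule ell2_finite_support) simp
    from ell2_translate[OF this, of "- s"] have "lower_bound_at v \<omega>' z C u'"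
      by (intro C) (simp add: u'_def[abs_def])
    moreover have "complex_of_real (v (\<omega>' n)) * u' n = complex_of_real (v (\<omega> (n - s))) * u (n - s)" for n
      using bspec[OF s, of "n - s"] by (cases "u (n - s) = 0") (auto simp: u'_def)
    then have "(\<lambda>n. schroedinger v \<omega>' u' n - z * u' n)
        = (\<lambda>n. schroedinger v \<omega> u (n + - s) - z * u (n + - s))"
      by (simp add: schroedinger_def u'_def fun_eq_iff algebra_simps)
    moreover have "u' = (\<lambda>n. u (n + - s))" by (simp add: u'_def fun_eq_iff)
    ultimately show ?thesis
      using ell2_norm_translate[of u "- s"]
        ell2_norm_translate[of "\<lambda>n. schroedinger v \<omega> u n - z * u n" "- s"]
      by (simp only: lower_bound_at_def)
  qed
  then show "z \<in> resolvent_set (schroedinger v \<omega>)"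
    unfolding resolvent_iff_bounded_below[OF fin(1)]
    using lower_bound_at_if_finite_support[OF fin(1)] by blast
qed

lemma spectrum_eq_if_same_words:
  assumes "finite (range \<omega>)" "finite (range \<omega>')" "\<And>w. occurs w \<omega> \<longleftrightarrow> occurs w \<omega>'"
  shows "spectrum (schroedinger v \<omega>) = spectrum (schroedinger v \<omega>')"
  unfolding spectrum_def
  using resolvent_set_mono_words[of \<omega> \<omega>'] resolvent_set_mono_words[of \<omega>' \<omega>] assms by blast

section \<open>Plane waves on constant blocks\<close>

lemma cis_recurrence: "cis (\<theta> * real_of_int (n + 1)) + cis (\<theta> * real_of_int (n - 1))
    = 2 * complex_of_real (cos \<theta>) * cis (\<theta> * real_of_int n)"
proof -
  have "cis (\<theta> * real_of_int (n + 1)) + cis (\<theta> * real_of_int (n - 1))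
      = cis (\<theta> * real_of_int n) * (cis \<theta> + cis (- \<theta>))"
    by (simp add: cis_mult algebra_simps)
  then show ?thesis by (simp add: complex_eq_iff)
qed

text \<open>
  The plane wave solves the eigenvalue equation wherever the cut-off is not felt. The two end sites of
  the block and their outer neighbours remain, and at each of them the defect is a single missing or
  surplus phase of modulus 1. The condition \<open>2 \<le> N\<close> keeps the two ends of the block apart.
\<close>

lemma plane_wave_residual:
  assumes block: "\<And>j. j < N \<Longrightarrow> \<omega> (s + int j) = i" and N: "2 \<le> N"
    and E: "E = v i + 2 * cos \<theta>"
  defines "u \<equiv> \<lambda>n. if s \<le> n \<and> n < s + int N then cis (\<theta> * real_of_int n) else 0"
  shows "ell2_norm u = sqrt (real N)"
    and "ell2_norm (\<lambda>n. schroedinger v \<omega> u n - complex_of_real E * u n) \<le> 2"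
proof -
  define e where "e n = cis (\<theta> * real_of_int n)" for n
  have u: "u n = (if s \<le> n \<and> n < s + int N then e n else 0)" for n by (simp add: u_def e_def)
  have cmod_e: "cmod (e n) = 1" for n by (simp add: e_def)
  have "(ell2_norm u)\<^sup>2 = (\<Sum>n\<in>{s..<s + int N}. (cmod (u n))\<^sup>2)"
    by (rule ell2_norm_finite_support) (auto simp: u)
  also have "\<dots> = (\<Sum>n\<in>{s..<s + int N}. 1)" by (rule sum.cong) (auto simp: u cmod_e)
  finally have "(ell2_norm u)\<^sup>2 = real N" by simp
  moreover have "0 \<le> ell2_norm u" by (simp add: ell2_norm_def infsum_nonneg)
  ultimately show "ell2_norm u = sqrt (real N)" by (metis real_sqrt_unique)
  define r where "r n = schroedinger v \<omega> u n - complex_of_real E * u n" for n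
  let ?F = "{s - 1, s, s + int N - 1, s + int N}"
  have \<omega>: "\<omega> n = i" if "s \<le> n" "n < s + int N" for n
    using block[of "nat (n - s)"] that by simp
  have bulk: "e (n + 1) + e (n - 1) + complex_of_real (v i) * e n = complex_of_real E * e n" for n
    unfolding e_def cis_recurrence E by (simp add: distrib_right)
  have zero: "r n = 0" if "n \<notin> ?F" for n
  proof (cases "s \<le> n \<and> n < s + int N")
    case True
    then have "u (n + 1) = e (n + 1)" "u (n - 1) = e (n - 1)" "u n = e n" "\<omega> n = i"
      using that \<omega>[of n] by (auto simp: u)
    then show ?thesis using bulk[of n] by (simp add: r_def schroedinger_def)
  next
    case False
    then have "u (n + 1) = 0" "u (n - 1) = 0" "u n = 0" using that by (auto simp: u)
    then show ?thesis by (simp add: r_def schroedinger_def)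
  qed
  have "u (s + 1) = e (s + 1)" "u (s - 1) = 0" "u s = e s" "\<omega> s = i"
    using \<omega>[of s] N by (auto simp: u)
  then have left: "r s = - e (s - 1)"
    using bulk[of s] by (simp add: r_def schroedinger_def add_diff_eq flip: bulk)
  let ?t = "s + int N - 1"
  have "u (?t + 1) = 0" "u (?t - 1) = e (?t - 1)" "u ?t = e ?t" "\<omega> ?t = i"
    using \<omega>[of ?t] N by (auto simp: u)
  then have right: "r ?t = - e (?t + 1)"
    using bulk[of ?t] by (simp add: r_def schroedinger_def add_diff_eq flip: bulk)
  have "u s = e s" "u (s - 1) = 0" "u (s - 2) = 0" using N by (auto simp: u)
  then have outer_left: "r (s - 1) = e s" by (simp add: r_def schroedinger_def)
  have "u (s + int N) = 0" "u (s + int N + 1) = 0" "u (s + int N - 1) = e (s + int N - 1)"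
    using N by (auto simp: u)
  then have outer_right: "r (s + int N) = e (s + int N - 1)" by (simp add: r_def schroedinger_def)
  have one: "cmod (r n) \<le> 1" if "n \<in> ?F" for n
    using that by (auto simp: left right outer_left outer_right cmod_e simp del: of_int_diff)
  have "(ell2_norm r)\<^sup>2 = (\<Sum>n\<in>?F. (cmod (r n))\<^sup>2)"
    by (rule ell2_norm_finite_support) (use zero in auto)
  also have "\<dots> \<le> (\<Sum>n\<in>?F. 1)"
    by (intro sum_mono power_le_one one) auto
  also have "\<dots> = real (card ?F)" by simp
  also have "\<dots> \<le> 2\<^sup>2"
    using card_length[of "[s - 1, s, s + int N - 1, s + int N]"] by simp
  finally show "ell2_norm (\<lambda>n. schroedinger v \<omega> u n - complex_of_real E * u n) \<le> 2"
    unfolding r_def by (rule power2_le_imp_le) simp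
qed

text \<open>
  The cut-off plane waves have norm \<open>sqrt N\<close> with \<open>N\<close> arbitrary and residual at most 2, which no constant
  \<open>C\<close> can accommodate.
\<close>

lemma constant_blocks_spectrum:
  assumes fin: "finite (range \<omega>)" and blocks: "\<And>N. occurs (replicate N i) \<omega>"
    and E: "E \<in> {- 2 + v i .. 2 + v i}"
  shows "complex_of_real E \<in> spectrum (schroedinger v \<omega>)"
proof (rule ccontr)
  assume "complex_of_real E \<notin> spectrum (schroedinger v \<omega>)"
  then obtain C where C: "\<And>u. u \<in> ell2 \<Longrightarrow> lower_bound_at v \<omega> E C u"
    unfolding spectrum_def using resolvent_iff_bounded_below[OF fin] by blast
  define \<theta> where "\<theta> = arccos ((E - v i) / 2)"
  have \<theta>: "E = v i + 2 * cos \<theta>" using E by (simp add: \<theta>_def field_simps)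
  obtain N :: nat where N: "real N > max 2 ((\<bar>C\<bar> * 2)\<^sup>2)" using reals_Archimedean2 by blast
  obtain s where s: "\<And>j. j < N \<Longrightarrow> \<omega> (s + int j) = i"
    using blocks[of N] by (auto simp: occurs_def)
  define u where "u n = (if s \<le> n \<and> n < s + int N then cis (\<theta> * real_of_int n) else 0)" for n
  have u: "ell2_norm u = sqrt (real N)"
      "ell2_norm (\<lambda>n. schroedinger v \<omega> u n - complex_of_real E * u n) \<le> 2"
    unfolding u_def using plane_wave_residual[where v=v and \<omega>=\<omega> and s=s and N=N and i=i, OF s _ \<theta>] N by simp_all
  have "u \<in> ell2" by (rule ell2_finite_support[of "{s..<s + int N}"]) (auto simp: u_def)
  from C[OF this] have "sqrt (real N) \<le> C * ell2_norm (\<lambda>n. schroedinger v \<omega> u n - complex_of_real E * u n)"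
    by (simp add: lower_bound_at_def u)
  also have "\<dots> \<le> \<bar>C\<bar> * 2"
    by (intro mult_mono u(2)) (auto simp: ell2_norm_def infsum_nonneg)
  finally have "real N \<le> (\<bar>C\<bar> * 2)\<^sup>2" by (rule sqrt_le_D)
  then show False using N by simp
qed

section \<open>Words in ergodic subshifts\<close>

lemma sets_occurs:
  assumes "sets \<mu> = sets (restrict_space borel \<Omega>)"
  shows "{\<omega> \<in> \<Omega>. occurs w \<omega>} \<in> sets (\<mu> :: (int \<Rightarrow> nat) measure)"
proof -
  have site: "open {\<omega> :: int \<Rightarrow> nat. \<omega> n = a}" for n a
    using open_vimage[OF _ continuous_on_product_coordinates, of "{a}" n]
    by (simp add: vimage_def Topological_Spaces.open_discrete)
  have "{\<omega> :: int \<Rightarrow> nat. occurs w \<omega>} = (\<Union>s. \<Inter>j\<in>{..<length w}. {\<omega>. \<omega> (s + int j) = w ! j})"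
    by (auto simp: occurs_def)
  moreover have "open \<dots>" by (intro open_UN ballI open_INT site) simp
  ultimately have "{\<omega> :: int \<Rightarrow> nat. occurs w \<omega>} \<in> sets borel" by simp
  moreover have "{\<omega> \<in> \<Omega>. occurs w \<omega>} = \<Omega> \<inter> {\<omega>. occurs w \<omega>}" by auto
  ultimately show ?thesis unfolding assms sets_restrict_space by blast
qed

lemma occurs_shift: "occurs w (shift \<omega>) \<longleftrightarrow> occurs w \<omega>"
proof -
  have "occurs w (shift \<omega>) \<longleftrightarrow> (\<exists>s. \<forall>j<length w. \<omega> (s + 1 + int j) = w ! j)"
    by (simp add: occurs_def shift_def algebra_simps)
  also have "\<dots> \<longleftrightarrow> occurs w \<omega>"
    unfolding occurs_def by (metis diff_add_cancel)
  finally show ?thesis .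
qed

text \<open>
  Occurrence anywhere in a two-sided sequence does not change under the shift, so this is the ergodic
  alternative for a strictly invariant set.
\<close>

lemma occurs_zero_one:
  assumes sub: "subshift k \<Omega>" and erg: "ergodic_prob \<Omega> \<mu>"
  shows "emeasure \<mu> {\<omega> \<in> \<Omega>. occurs w \<omega>} = 0 \<and> (AE \<omega> in \<mu>. \<not> occurs w \<omega>)
       \<or> (AE \<omega> in \<mu>. occurs w \<omega>)"
proof -
  let ?A = "{\<omega> \<in> \<Omega>. occurs w \<omega>}"
  have sets: "sets \<mu> = sets (restrict_space borel \<Omega>)" and prob: "prob_space \<mu>"
    using erg by (auto simp: ergodic_prob_def shift_invariant_prob_def)
  interpret prob_space \<mu> by fact
  have space: "space \<mu> = \<Omega>"
    using sets_eq_imp_space_eq[OF sets] by (simp add: space_restrict_space)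
  have A: "?A \<in> sets \<mu>" by (rule sets_occurs[OF sets])
  have "shift \<omega> \<in> \<Omega>" if "\<omega> \<in> \<Omega>" for \<omega> using sub that by (auto simp: subshift_def)
  then have "shift -` ?A \<inter> space \<mu> = ?A" by (auto simp: space occurs_shift)
  then have "emeasure \<mu> ?A = 0 \<or> emeasure \<mu> ?A = 1"
    using erg A by (simp add: ergodic_prob_def)
  then show ?thesis
  proof
    assume 0: "emeasure \<mu> ?A = 0"
    then have "AE \<omega> in \<mu>. \<omega> \<notin> ?A" using A by (intro AE_not_in) (simp add: null_setsI)
    then have "AE \<omega> in \<mu>. \<not> occurs w \<omega>" by (rule AE_mp) (auto simp: space)
    with 0 show ?thesis by blast
  next
    assume "emeasure \<mu> ?A = 1"
    then have "AE \<omega> in \<mu>. \<omega> \<in> ?A" using A by (intro AE_prob_1) (simp add: measure_def)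
    then show ?thesis by auto
  qed
qed

theorem theorem5:
  fixes k i :: nat and \<Omega> :: "(int \<Rightarrow> nat) set" and \<mu> :: "(int \<Rightarrow> nat) measure"
    and v :: "nat \<Rightarrow> real"
  assumes "k \<ge> 2"
    and "subshift k \<Omega>"
    and "ergodic_prob \<Omega> \<mu>"
    and "i \<in> {1..k}"
    and "\<And>N::nat. N > 0 \<Longrightarrow> emeasure \<mu> {\<omega> \<in> \<Omega>. \<forall>j\<in>{0..<int N}. \<omega> j = i} > 0"
  shows "complex_of_real ` {- 2 + v i .. 2 + v i} \<subseteq> almost_sure_spectrum \<mu> v"
proof -
  have sets: "sets \<mu> = sets (restrict_space borel \<Omega>)" and prob: "prob_space \<mu>"
    using assms(3) by (auto simp: ergodic_prob_def shift_invariant_prob_def)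
  interpret prob_space \<mu> by fact
  have space: "space \<mu> = \<Omega>"
    using sets_eq_imp_space_eq[OF sets] by (simp add: space_restrict_space)
  have fin: "finite (range \<omega>)" if "\<omega> \<in> \<Omega>" for \<omega>
    using assms(2) that by (intro finite_subset[of "range \<omega>" "{1..k}"]) (auto simp: subshift_def)
  \<comment> \<open>the words that occur almost surely; they make up the language of almost every point\<close>
  define L where "L = {w. AE \<omega> in \<mu>. occurs w \<omega>}"
  have "AE \<omega> in \<mu>. \<forall>w. occurs w \<omega> \<longleftrightarrow> w \<in> L"
    unfolding AE_all_countable
  proof
    fix w
    show "AE \<omega> in \<mu>. occurs w \<omega> \<longleftrightarrow> w \<in> L"
      using occurs_zero_one[OF assms(2,3), of w] unfolding L_def
      by (cases "AE \<omega> in \<mu>. occurs w \<omega>") auto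
  qed
  then have AE_L: "AE \<omega> in \<mu>. \<omega> \<in> \<Omega> \<and> (\<forall>w. occurs w \<omega> \<longleftrightarrow> w \<in> L)"
    using AE_space by eventually_elim (simp add: space)
  then obtain \<omega>\<^sub>0 where \<omega>\<^sub>0: "\<omega>\<^sub>0 \<in> \<Omega>" "\<And>w. occurs w \<omega>\<^sub>0 \<longleftrightarrow> w \<in> L"
    using eventually_happens'[OF ae_filter_bot AE_L] by blast
  let ?S = "spectrum (schroedinger v \<omega>\<^sub>0)"
  have AE_S: "AE \<omega> in \<mu>. spectrum (schroedinger v \<omega>) = ?S"
    using AE_L by eventually_elim (intro spectrum_eq_if_same_words, simp_all add: fin \<omega>\<^sub>0)
  have "almost_sure_spectrum \<mu> v = ?S"
    unfolding almost_sure_spectrum_def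
  proof (rule the_equality[where P="\<lambda>S. AE \<omega> in \<mu>. spectrum (schroedinger v \<omega>) = S", OF AE_S])
    fix S assume "AE \<omega> in \<mu>. spectrum (schroedinger v \<omega>) = S"
    with AE_S have "AE \<omega> in \<mu>. S = ?S" by eventually_elim simp
    then show "S = ?S" by simp
  qed
  moreover have "replicate N i \<in> L" for N
  proof (rule ccontr)
    assume "replicate N i \<notin> L"
    then have "emeasure \<mu> {\<omega> \<in> \<Omega>. occurs (replicate N i) \<omega>} = 0"
      using occurs_zero_one[OF assms(2,3), of "replicate N i"] by (simp add: L_def)
    \<comment> \<open>\<open>Suc N\<close> instead of \<open>N\<close> because the blocks in the hypothesis have positive length\<close>
    moreover have "{\<omega> \<in> \<Omega>. \<forall>j\<in>{0..<int (Suc N)}. \<omega> j = i} \<subseteq> {\<omega> \<in> \<Omega>. occurs (replicate N i) \<omega>}"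
      unfolding occurs_def by (intro Collect_mono conj_mono impI exI[of _ 0]) simp_all
    then have "emeasure \<mu> {\<omega> \<in> \<Omega>. \<forall>j\<in>{0..<int (Suc N)}. \<omega> j = i}
        \<le> emeasure \<mu> {\<omega> \<in> \<Omega>. occurs (replicate N i) \<omega>}"
      by (intro emeasure_mono sets_occurs[OF sets])
    ultimately show False using assms(5)[of "Suc N"] by simp
  qed
  ultimately show ?thesis
    using constant_blocks_spectrum[of \<omega>\<^sub>0 i _ v, OF fin[OF \<omega>\<^sub>0(1)]] \<omega>\<^sub>0(2) by blast
qed

end
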